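(* Let $f,g$ be proper, lower semicontinuous and convex functions on $\mathbb{R}^n$, with $f$ additionally $L$-smooth (differentiable with $L$-Lipschitz gradient). Consider the HJ-Prox-based proximal gradient descent iteration $$x_{k+1}=\operatorname{prox}^{\delta_k}_{tg}\bigl(x_k-t\nabla f(x_k)\bigr),\qquad k=1,2,\dots,$$ with step size $0<t<2/L$ and with $\{\sqrt{\delta_k}\}_{k\ge1}$ a summable sequence ($\delta_k>0$). Then $x_k$ converges to a minimizer of $f+g$.
   Context: For a function $\varphi$ on $\mathbb{R}^n$, $t>0$ and $\delta>0$, the HJ-Prox of $\varphi$ is the map $$\operatorname{prox}^{\delta}_{t\varphi}(x)=\frac{\mathbb{E}_{y\sim\mathcal{N}(x,\delta tI)}\left[y\,\exp(-\varphi(y)/\delta)\right]}{\mathbb{E}_{y\sim\mathcal{N}(x,\delta tI)}\left[\exp(-\varphi(y)/\delta)\right]},$$ where $\mathcal{N}(x,\delta tI)$ is the Gaussian distribution on $\mathbb{R}^n$ with mean $x$ and covariance matrix $\delta tI$. It is an approximation of the proximal operator $\operatorname{prox}_{t\varphi}(x)=\arg\min_{z}\{\varphi(z)+\frac{1}{2t}\|z-x\|^2\}$. The expectations are evaluated exactly (no Monte Carlo sampling error).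
   Formalization: It is additionally assumed that f+g has a minimizer (false otherwise: f=0, g linear and nonzero makes x_k diverge) and that the denominator of the HJ-Prox is nonzero at each x_k − t∇f(x_k) (otherwise the quotient is 0/0, e.g. when the domain of g is a null set). *)

theory Defs
  imports "HOL-Analysis.Analysis"
begin

definition proper_fun :: "('a \<Rightarrow> ereal) \<Rightarrow> bool" where
  "proper_fun h \<longleftrightarrow> (\<forall>x. h x \<noteq> -\<infinity>) \<and> (\<exists>x. h x \<noteq> \<infinity>)"

definition lsc_fun :: "('a::topological_space \<Rightarrow> ereal) \<Rightarrow> bool" where
  "lsc_fun h \<longleftrightarrow> (\<forall>x. \<forall>c < h x. eventually (\<lambda>y. c < h y) (nhds x))"

(* Intended for proper h: no sum of opposite infinities then occurs on the right. *)
definition convex_fun :: "('a::real_vector \<Rightarrow> ereal) \<Rightarrow> bool" where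
  "convex_fun h \<longleftrightarrow> (\<forall>x y. \<forall>u::real. 0 < u \<and> u < 1 \<longrightarrow>
      h ((1 - u) *\<^sub>R x + u *\<^sub>R y) \<le> ereal (1 - u) * h x + ereal u * h y)"

definition gaussian :: "'a::euclidean_space \<Rightarrow> real \<Rightarrow> 'a measure" where
  "gaussian m v = density lborel (\<lambda>y. ennreal
      ((2 * pi * v) powr (- real DIM('a) / 2) * exp (- (norm (y - m))\<^sup>2 / (2 * v))))"

(* exp (- h y / d) with the convention exp (-\<infinity>) = 0; the value at h y = -\<infinity> is irrelevant
   for proper functions. *)
definition gibbs_weight :: "('a \<Rightarrow> ereal) \<Rightarrow> real \<Rightarrow> 'a \<Rightarrow> real" where
  "gibbs_weight h d y = (if h y = \<infinity> then 0 else exp (- real_of_ereal (h y) / d))"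

definition hj_denom :: "real \<Rightarrow> real \<Rightarrow> ('a::euclidean_space \<Rightarrow> ereal) \<Rightarrow> 'a \<Rightarrow> real" where
  "hj_denom d t h x = (\<integral>y. gibbs_weight h d y \<partial>gaussian x (d * t))"

(* Meaningful only where hj_denom is nonzero; it vanishes exactly when the effective domain
   of h is a null set (for proper, lower semicontinuous, convex h and d, t > 0). *)
definition hj_prox :: "real \<Rightarrow> real \<Rightarrow> ('a::euclidean_space \<Rightarrow> ereal) \<Rightarrow> 'a \<Rightarrow> 'a" where
  "hj_prox d t h x =
     (\<integral>y. gibbs_weight h d y *\<^sub>R y \<partial>gaussian x (d * t)) /\<^sub>R hj_denom d t h x"

end

theory Submission
  imports Defs
begin

text \<open>Let \<open>p\<close> be the exact proximal point of \<open>v\<close> and let \<open>W\<close> be the Gibbs density whose mean is the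
  HJ-Prox of \<open>v\<close>. Strong convexity gives
  \<open>norm (y - p) * W y \<le> sqrt (d * t) * W ((p + y) / 2)\<close> for every \<open>y\<close>; integrating and substituting
  shows that the HJ-Prox is within \<open>2 ^ n * sqrt (d * t)\<close> of \<open>p\<close>. The iteration is therefore an
  iteration of the forward-backward operator with summable errors. By the Baillon--Haddad theorem
  this operator is averaged, and its fixed points are the minimizers; the distances to a fixed point
  are monotone up to the errors, hence converge, so the fixed-point residuals vanish and every
  cluster point is a fixed point; the distance to it then tends to 0 along the whole sequence.\<close>

section \<open>Subgradients and proximal points\<close>

text \<open>Finiteness at \<open>p\<close> rules out the value -\<infinity>, for which every
  \<open>s\<close> would qualify. For proper convex \<open>h\<close>, the optimality condition of
  the proximal point \<open>p\<close> of \<open>v\<close> is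
  \<open>subgradient h p ((v - p) /\<^sub>R t)\<close>, the form in which proximal points appear
  throughout.\<close>

definition subgradient :: "('a::real_inner \<Rightarrow> ereal) \<Rightarrow> 'a \<Rightarrow> 'a \<Rightarrow> bool" where
  "subgradient h p s \<longleftrightarrow> \<bar>h p\<bar> \<noteq> \<infinity> \<and> (\<forall>y. h p + ereal (s \<bullet> (y - p)) \<le> h y)"

lemma subgradient_finite:
  assumes "subgradient h p s"
  obtains r where "h p = ereal r" "\<And>y. ereal (r + s \<bullet> (y - p)) \<le> h y"
proof -
  from assms obtain r where "h p = ereal r" unfolding subgradient_def by (cases "h p") auto
  moreover from this have "\<And>y. ereal (r + s \<bullet> (y - p)) \<le> h y"
    using assms unfolding subgradient_def by simp
  ultimately show thesis using that by blast
qed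

text \<open>Each subgradient inequality is tested at the other base point; in the sum the function
  values cancel.\<close>

lemma subgradient_monotone:
  assumes "subgradient h p a" "subgradient h q b"
  shows "0 \<le> (a - b) \<bullet> (p - q)"
proof -
  obtain r where r: "h p = ereal r" "\<And>y. ereal (r + a \<bullet> (y - p)) \<le> h y"
    using subgradient_finite[OF assms(1)] by blast
  obtain r' where r': "h q = ereal r'" "\<And>y. ereal (r' + b \<bullet> (y - q)) \<le> h y"
    using subgradient_finite[OF assms(2)] by blast
  have "r + a \<bullet> (q - p) \<le> r'" using r(2)[of q] r'(1) by simp
  moreover have "r' + b \<bullet> (p - q) \<le> r" using r'(2)[of p] r(1) by simp
  ultimately show ?thesis by (simp add: inner_simps)
qed

section \<open>Directional derivatives and Fermat's rule\<close>

lemma gderiv_along_line: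
  assumes "GDERIV \<phi> (p + s *\<^sub>R w) :> d"
  shows "((\<lambda>u. \<phi> (p + u *\<^sub>R w)) has_real_derivative d \<bullet> w) (at s)"
proof -
  have "((\<lambda>u. p + u *\<^sub>R w) has_derivative (\<lambda>u. u *\<^sub>R w)) (at s)"
    by (auto intro!: derivative_eq_intros)
  moreover have "(\<phi> has_derivative (\<lambda>h. h \<bullet> d)) (at (p + s *\<^sub>R w))"
    using assms by (simp add: gderiv_def)
  ultimately have "((\<lambda>u. \<phi> (p + u *\<^sub>R w)) has_derivative (\<lambda>u. (u *\<^sub>R w) \<bullet> d)) (at s)"
    by (rule has_derivative_compose)
  then show ?thesis
    unfolding has_field_derivative_def
    by (rule has_derivative_eq_rhs) (auto simp: inner_commute mult.commute)
qed

lemma gderiv_directional_limit: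
  assumes "GDERIV \<phi> p :> d"
  shows "((\<lambda>u. (\<phi> (p + u *\<^sub>R w) - \<phi> p) / u) \<longlongrightarrow> d \<bullet> w) (at_right 0)"
proof -
  have "((\<lambda>u. \<phi> (p + u *\<^sub>R w)) has_real_derivative d \<bullet> w) (at 0)"
    using gderiv_along_line[of \<phi> p 0 w d] assms by simp
  then have "((\<lambda>u. (\<phi> (p + u *\<^sub>R w) - \<phi> p) / u) \<longlongrightarrow> d \<bullet> w) (at 0)"
    by (simp add: has_field_derivative_iff)
  then show ?thesis by (rule tendsto_within_subset) auto
qed

text \<open>Compare \<open>p\<close> with the points \<open>p + u *\<^sub>R (y - p)\<close>:
  convexity makes the increment of \<open>h\<close> at most linear in \<open>u\<close>; dividing by
  \<open>u\<close> and letting \<open>u\<close> tend to 0 leaves the directional derivative of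
  \<phi>. Since \<phi> is merely differentiable at \<open>p\<close>, it may even be concave.\<close>

lemma fermat_subgradient:
  fixes \<phi> :: "'a::real_inner \<Rightarrow> real"
  assumes h: "proper_fun h" "convex_fun h"
    and \<phi>: "GDERIV \<phi> p :> d"
    and min: "\<And>y. ereal (\<phi> p) + h p \<le> ereal (\<phi> y) + h y"
  shows "subgradient h p (- d)"
proof -
  obtain y0 r0 where y0: "h y0 = ereal r0"
    using h(1) unfolding proper_fun_def by (metis ereal_cases)
  obtain r where r: "h p = ereal r"
    using min[of y0] y0 h(1) unfolding proper_fun_def by (cases "h p") auto
  have "r - d \<bullet> (y - p) \<le> q" if q: "h y = ereal q" for y q
  proof -
    have "r - q \<le> (\<phi> (p + u *\<^sub>R (y - p)) - \<phi> p) / u" if u: "0 < u" "u < 1" for u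
    proof -
      let ?m = "p + u *\<^sub>R (y - p)"
      have "h ?m = h ((1 - u) *\<^sub>R p + u *\<^sub>R y)" by (simp add: algebra_simps)
      also have "\<dots> \<le> ereal ((1 - u) * r + u * q)"
        using h(2)[unfolded convex_fun_def, rule_format, of u p y] u r q by simp
      finally have hm: "h ?m \<le> ereal ((1 - u) * r + u * q)" .
      then have "ereal (\<phi> p + r) \<le> ereal (\<phi> ?m + ((1 - u) * r + u * q))"
        using order.trans[OF min[of ?m] add_left_mono[OF hm, of "ereal (\<phi> ?m)"]] r by simp
      then have "u * (r - q) \<le> \<phi> ?m - \<phi> p" by (simp add: algebra_simps)
      then show ?thesis using u by (simp add: field_simps)
    qed
    then have "\<forall>\<^sub>F u in at_right 0. r - q \<le> (\<phi> (p + u *\<^sub>R (y - p)) - \<phi> p) / u"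
      unfolding eventually_at_right_field by (intro exI[of _ 1]) auto
    from tendsto_lowerbound[OF gderiv_directional_limit[OF \<phi>, of "y - p"] this]
    show ?thesis by simp
  qed
  then have "h p + ereal (- d \<bullet> (y - p)) \<le> h y" for y
    using h(1) r unfolding proper_fun_def by (cases "h y") auto
  then show ?thesis unfolding subgradient_def using r by simp
qed

lemma convex_gradient_inequality:
  fixes f :: "'a::real_inner \<Rightarrow> real"
  assumes "convex_fun (\<lambda>y. ereal (f y))" "GDERIV f x :> d"
  shows "f x + d \<bullet> (y - x) \<le> f y"
proof -
  \<comment> \<open>With \<phi> = -f the sum is constantly 0, so every point minimizes it.\<close>
  have "subgradient (\<lambda>y. ereal (f y)) x (- (- d))"
    by (rule fermat_subgradient[where \<phi> = "\<lambda>y. - f y"])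
      (use assms in \<open>auto simp: proper_fun_def intro: GDERIV_minus\<close>)
  then show ?thesis unfolding subgradient_def by simp
qed

section \<open>Lower semicontinuity and existence of proximal points\<close>

lemma lsc_fun_add_continuous:
  fixes \<phi> :: "'a::topological_space \<Rightarrow> real"
  assumes h: "proper_fun h" "lsc_fun h" and \<phi>: "continuous_on UNIV \<phi>"
  shows "lsc_fun (\<lambda>y. ereal (\<phi> y) + h y)"
  unfolding lsc_fun_def
proof (intro allI impI)
  fix x c assume c: "c < ereal (\<phi> x) + h x"
  show "\<forall>\<^sub>F y in nhds x. c < ereal (\<phi> y) + h y"
  proof (cases c)
    case (real a)
    have "ereal (a - \<phi> x) < h x"
      using c real h(1) unfolding proper_fun_def by (cases "h x") auto
    \<comment> \<open>\<open>b\<close> divides the slack between the summands: near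
      \<open>x\<close>, \<open>h\<close> stays above \<open>b\<close> and \<phi> above
      \<open>a - b\<close>.\<close>
    then obtain b where b: "ereal (a - \<phi> x) < ereal b" "ereal b < h x"
      using ereal_dense2 by blast
    have "\<forall>\<^sub>F y in nhds x. ereal b < h y" using h(2) b(2) unfolding lsc_fun_def by blast
    moreover have "\<forall>\<^sub>F y in nhds x. a - b < \<phi> y"
    proof -
      have "(\<phi> \<longlongrightarrow> \<phi> x) (nhds x)"
        using continuous_on_tendsto_compose[OF \<phi> filterlim_ident] by simp
      then show ?thesis using b(1) by (intro order_tendstoD(1)) auto
    qed
    ultimately show ?thesis
    proof eventually_elim
      case (elim y)
      then show ?case using real by (cases "h y") auto
    qed
  next
    case MInf
    then show ?thesis using h(1) unfolding proper_fun_def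
      by (auto intro!: always_eventually)
  qed (use c in auto)
qed

lemma lsc_fun_open_superlevel:
  assumes "lsc_fun h"
  shows "open {y. c < h y}"
proof (subst open_subopen, intro ballI)
  fix x assume "x \<in> {y. c < h y}"
  then have "\<forall>\<^sub>F y in nhds x. c < h y" using assms unfolding lsc_fun_def by blast
  then show "\<exists>T. open T \<and> x \<in> T \<and> T \<subseteq> {y. c < h y}" unfolding eventually_nhds by blast
qed

text \<open>Without a minimizer the open sets \<open>{y. h q < h y}\<close> with \<open>q\<close> in
  \<open>K\<close> would cover \<open>K\<close>. Among the finitely many \<open>q\<close> of a
  subcover, one of least value lies in none of the chosen sets.\<close>

lemma lsc_fun_attains_min:
  assumes "lsc_fun h" "compact K" "K \<noteq> {}"
  obtains p where "p \<in> K" "\<And>y. y \<in> K \<Longrightarrow> h p \<le> h y"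
proof (rule ccontr)
  assume "\<not> thesis"
  then have "\<forall>p\<in>K. \<exists>y\<in>K. h y < h p" using that by (meson not_le)
  then have "K \<subseteq> (\<Union>q\<in>K. {y. h q < h y})" by auto
  then obtain C where C: "C \<subseteq> K" "finite C" "K \<subseteq> (\<Union>q\<in>C. {y. h q < h y})"
    using compactE_image[OF assms(2), of K "\<lambda>q. {y. h q < h y}"] lsc_fun_open_superlevel[OF assms(1)]
    by metis
  then have "C \<noteq> {}" using assms(3) by auto
  then obtain q where q: "q \<in> C" "\<forall>y\<in>C. h q \<le> h y"
    using C(2) by (metis (no_types, lifting) arg_min_if_finite(1) arg_min_least)
  then show False using C(1,3) by force
qed

text \<open>The subgradient at \<open>z\<close> gives an affine minorant of \<open>h\<close>. With
  the quadratic added, the objective is at least its value at \<open>z\<close> outside a ball, so a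
  minimizer over the compact ball is global, and Fermat's rule applies to it.\<close>

lemma prox_exists:
  fixes h :: "'a::euclidean_space \<Rightarrow> ereal"
  assumes h: "proper_fun h" "lsc_fun h" "convex_fun h" and t: "0 < t" and s: "subgradient h z s"
  obtains p where "subgradient h p ((v - p) /\<^sub>R t)"
proof -
  define \<phi> where "\<phi> y = (norm (y - v))\<^sup>2 / (2 * t)" for y
  obtain r where r: "h z = ereal r" "\<And>y. ereal (r + s \<bullet> (y - z)) \<le> h y"
    using subgradient_finite[OF s] by blast
  \<comment> \<open>\<open>a\<close> is the slope at \<open>z\<close> of the minorant plus the
    quadratic; beyond radius \<open>2 * t * norm a\<close> the remaining term
    \<open>(norm (y - z))\<^sup>2 / (2 * t)\<close> outweighs the linear loss
    \<open>norm a * norm (y - z)\<close>.\<close>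
  define a where "a = s + (z - v) /\<^sub>R t"
  define K where "K = cball z (2 * t * norm a)"
  have cont: "continuous_on UNIV \<phi>" unfolding \<phi>_def by (intro continuous_intros) (use t in auto)
  have "z \<in> K" using t by (simp add: K_def)
  then have "compact K" "K \<noteq> {}" by (auto simp: K_def)
  then obtain p where p: "p \<in> K" "\<And>y. y \<in> K \<Longrightarrow> ereal (\<phi> p) + h p \<le> ereal (\<phi> y) + h y"
    using lsc_fun_attains_min[OF lsc_fun_add_continuous[OF h(1,2) cont]] by metis
  have out: "ereal (\<phi> z) + h z \<le> ereal (\<phi> y) + h y" if "y \<notin> K" for y
  proof -
    let ?b = "norm (y - z)"
    have b: "2 * t * norm a < ?b" using that by (simp add: K_def dist_norm norm_minus_commute)
    have eq: "\<phi> y + s \<bullet> (y - z) = \<phi> z + a \<bullet> (y - z) + ?b\<^sup>2 / (2 * t)"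
    proof -
      have "(norm (y - v))\<^sup>2 = (norm (z - v))\<^sup>2 + 2 * ((z - v) \<bullet> (y - z)) + ?b\<^sup>2"
        by (simp add: power2_norm_eq_inner inner_simps inner_commute)
      then have "\<phi> y = \<phi> z + ((z - v) \<bullet> (y - z)) / t + ?b\<^sup>2 / (2 * t)"
        using t unfolding \<phi>_def by (simp add: add_divide_distrib)
      moreover have "a \<bullet> (y - z) = s \<bullet> (y - z) + ((z - v) \<bullet> (y - z)) / t"
        unfolding a_def by (simp add: inner_add_left divide_inverse mult.commute)
      ultimately show ?thesis by simp
    qed
    have "- (norm a * ?b) \<le> a \<bullet> (y - z)"
      using Cauchy_Schwarz_ineq2[of a "y - z"] by linarith
    moreover have "norm a * ?b \<le> ?b\<^sup>2 / (2 * t)"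
      using b t mult_right_mono[of "2 * t * norm a" ?b ?b] by (simp add: field_simps power2_eq_square)
    ultimately have "\<phi> z + r \<le> \<phi> y + (r + s \<bullet> (y - z))" using eq by linarith
    then show ?thesis using r(1) r(2)[of y] by (cases "h y") auto
  qed
  have min: "ereal (\<phi> p) + h p \<le> ereal (\<phi> y) + h y" for y
    using p(2) out \<open>z \<in> K\<close> order.trans by (cases "y \<in> K") blast+
  have "GDERIV \<phi> p :> (p - v) /\<^sub>R t"
  proof -
    have "((\<lambda>y. (y - v) \<bullet> (y - v)) has_derivative (\<lambda>w. 2 * (w \<bullet> (p - v)))) (at p)"
      by (auto intro!: derivative_eq_intros simp: inner_commute)
    from has_derivative_mult_right[OF this, of "1 / (2 * t)"]
    have "(\<phi> has_derivative (\<lambda>w. 1 / (2 * t) * (2 * (w \<bullet> (p - v))))) (at p)"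
      by (simp add: \<phi>_def[abs_def] power2_norm_eq_inner)
    moreover have "1 / (2 * t) * (2 * (w \<bullet> (p - v))) = w \<bullet> ((p - v) /\<^sub>R t)" for w
      by (simp only: inner_scaleR_right) (use t in \<open>simp add: field_simps\<close>)
    ultimately show ?thesis by (simp only: gderiv_def)
  qed
  from fermat_subgradient[OF h(1,3) this min] show thesis
    using that[of p] by (simp add: scaleR_minus_right[symmetric] del: scaleR_minus_right)
qed

text \<open>The hypotheses say that \<open>p\<close> and \<open>q\<close> are the proximal points of \<open>v\<close> and \<open>w\<close>.\<close>

lemma prox_firmly_nonexpansive:
  assumes "subgradient h p ((v - p) /\<^sub>R t)" "subgradient h q ((w - q) /\<^sub>R t)" "0 < t"
  shows "(norm (p - q))\<^sup>2 \<le> (norm (v - w))\<^sup>2 - (norm ((v - w) - (p - q)))\<^sup>2"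
proof -
  have "0 \<le> ((v - p) /\<^sub>R t - (w - q) /\<^sub>R t) \<bullet> (p - q)"
    by (rule subgradient_monotone[OF assms(1,2)])
  also have "\<dots> = (((v - w) - (p - q)) \<bullet> (p - q)) / t"
    using assms(3) by (simp add: inner_simps field_simps)
  finally have "0 \<le> ((v - w) - (p - q)) \<bullet> (p - q)" using assms(3) by (simp add: zero_le_divide_iff)
  then show ?thesis by (simp add: power2_norm_eq_inner inner_simps inner_commute)
qed

section \<open>The error of the HJ-Prox\<close>

text \<open>Change of variables with Jacobian \<open>\<bar>c\<bar> ^ DIM('a)\<close>. The case
  \<open>c = 1/2\<close>, contraction towards the proximal point, is the source of the factor 2^n in
  the error bound.\<close>

lemma lborel_integral_affine:
  fixes F :: "'a::euclidean_space \<Rightarrow> real"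
  assumes F: "integrable lborel F" and c: "c \<noteq> 0"
  shows "integrable lborel (\<lambda>y. F (a + c *\<^sub>R y))"
    and "\<bar>c\<bar> ^ DIM('a) * (\<integral>y. F (a + c *\<^sub>R y) \<partial>lborel) = (\<integral>y. F y \<partial>lborel)"
proof -
  have [measurable]: "F \<in> borel_measurable borel" using F by auto
  have eq: "lborel = density (distr lborel borel (\<lambda>y. a + c *\<^sub>R y)) (\<lambda>_. ennreal (\<bar>c\<bar> ^ DIM('a)))"
    using lborel_affine[OF c, of a] by simp
  have "integrable (density (distr lborel borel (\<lambda>y. a + c *\<^sub>R y)) (\<lambda>_. ennreal (\<bar>c\<bar> ^ DIM('a)))) F"
    using F eq by simp
  then show "integrable lborel (\<lambda>y. F (a + c *\<^sub>R y))"
    using c by (simp add: integrable_density integrable_distr_eq)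
  have "(\<integral>y. F y \<partial>lborel)
      = (\<integral>y. F y \<partial>density (distr lborel borel (\<lambda>y. a + c *\<^sub>R y)) (\<lambda>_. ennreal (\<bar>c\<bar> ^ DIM('a))))"
    using eq by simp
  also have "\<dots> = \<bar>c\<bar> ^ DIM('a) * (\<integral>y. F (a + c *\<^sub>R y) \<partial>lborel)"
    by (simp add: integral_density integral_distr)
  finally show "\<bar>c\<bar> ^ DIM('a) * (\<integral>y. F (a + c *\<^sub>R y) \<partial>lborel) = (\<integral>y. F y \<partial>lborel)" by simp
qed

lemma gibbs_weight_nonneg: "0 \<le> gibbs_weight h d y"
  by (simp add: gibbs_weight_def)

lemma gibbs_weight_measurable:
  fixes h :: "'a::topological_space \<Rightarrow> ereal"
  assumes "lsc_fun h"
  shows "gibbs_weight h d \<in> borel_measurable borel"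
proof -
  have [measurable]: "h \<in> borel_measurable borel"
    by (rule borel_measurableI_greater) (simp add: lsc_fun_open_superlevel[OF assms])
  show ?thesis unfolding gibbs_weight_def by measurable
qed

text \<open>Let \<open>\<Phi> y = h y + (norm (y - v))\<^sup>2 / (2 * t)\<close>, minimal at \<open>p\<close>. Convexity at the midpoint \<open>m\<close>,
  with the quadratic gain 1/8 and half the quadratic growth 1/2 of \<open>\<Phi>\<close> away from \<open>p\<close>, yields
  \<open>\<Phi> m \<le> \<Phi> y - 3/8 * (norm (y - p))\<^sup>2 / t\<close>; the claim follows from \<open>u \<le> 1 + 3/8 * u\<^sup>2 \<le> exp (3/8 * u\<^sup>2)\<close>.\<close>

lemma gibbs_midpoint:
  fixes h :: "'a::euclidean_space \<Rightarrow> ereal" and v p :: 'a and d t :: real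
  defines "W \<equiv> \<lambda>y. exp (- (norm (y - v))\<^sup>2 / (2 * (d * t))) * gibbs_weight h d y"
  assumes h: "convex_fun h" and d: "0 < d" and t: "0 < t"
    and p: "subgradient h p ((v - p) /\<^sub>R t)"
  shows "norm (y - p) * W y \<le> sqrt (d * t) * W ((1/2) *\<^sub>R p + (1/2) *\<^sub>R y)"
proof (cases "h y = \<infinity>")
  case True
  then show ?thesis using d t by (simp add: W_def gibbs_weight_def)
next
  case False
  define m where "m = (1/2) *\<^sub>R p + (1/2) *\<^sub>R y"
  define \<Phi> where "\<Phi> x = real_of_ereal (h x) + (norm (x - v))\<^sup>2 / (2 * t)" for x
  obtain r where r: "h p = ereal r" "\<And>y. ereal (r + ((v - p) /\<^sub>R t) \<bullet> (y - p)) \<le> h y"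
    using subgradient_finite[OF p] by blast
  obtain q where q: "h y = ereal q" using False r(2)[of y] by (cases "h y") auto
  have rq: "r + ((v - p) /\<^sub>R t) \<bullet> (y - p) \<le> q" using r(2)[of y] q by simp
  have hm: "h m \<le> ereal (r / 2 + q / 2)"
    using h[unfolded convex_fun_def, rule_format, of "1/2" p y] r q by (simp add: m_def)
  then obtain k where k: "h m = ereal k" using r(2)[of m] by (cases "h m") auto
  have W: "W x = exp (- \<Phi> x / d)" if "h x = ereal c" for x c
    using that d t
    by (simp add: W_def gibbs_weight_def \<Phi>_def exp_add[symmetric] field_simps)
  let ?u = "norm (y - p) / sqrt (d * t)"
  have "\<Phi> m \<le> \<Phi> y - 3 * (norm (y - p))\<^sup>2 / (8 * t)"
  proof -
    have "k \<le> r / 2 + q / 2" using hm k by simp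
    moreover have "(norm (m - v))\<^sup>2 = (norm (p - v))\<^sup>2 / 2 + (norm (y - v))\<^sup>2 / 2 - (norm (y - p))\<^sup>2 / 4"
      unfolding m_def power2_norm_eq_inner
      by (simp add: inner_simps inner_commute field_simps)
    ultimately have "\<Phi> m \<le> r / 2 + q / 2 + ((norm (p - v))\<^sup>2 / 2 + (norm (y - v))\<^sup>2 / 2 - (norm (y - p))\<^sup>2 / 4) / (2 * t)"
      using k by (simp add: \<Phi>_def)
    also have "\<dots> = \<Phi> y - (q - r - ((v - p) /\<^sub>R t) \<bullet> (y - p)) / 2 - 3 * (norm (y - p))\<^sup>2 / (8 * t)"
      using q t unfolding \<Phi>_def power2_norm_eq_inner
      by (simp add: inner_simps inner_commute field_simps)
    also have "\<dots> \<le> \<Phi> y - 3 * (norm (y - p))\<^sup>2 / (8 * t)" using rq by simp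
    finally show ?thesis .
  qed
  then have "- \<Phi> y / d + 3/8 * ?u\<^sup>2 \<le> - \<Phi> m / d"
    using d t divide_right_mono[of "\<Phi> m" "\<Phi> y - 3 * (norm (y - p))\<^sup>2 / (8 * t)" d]
    by (simp add: power_divide diff_divide_distrib mult_ac)
  then have "exp (3/8 * ?u\<^sup>2) * W y \<le> W m"
    using W[OF k] W[OF q] by (simp add: exp_add[symmetric] add.commute)
  moreover have "?u \<le> exp (3/8 * ?u\<^sup>2)"
  proof -
    \<comment> \<open>4/3 minimizes \<open>3/8 * u\<^sup>2 - u\<close>; the square, scaled by 3/8,
      even gives \<open>u \<le> 2/3 + 3/8 * u\<^sup>2\<close>.\<close>
    have "0 \<le> (?u - 4/3)\<^sup>2" by simp
    then have "?u \<le> 1 + 3/8 * ?u\<^sup>2" by (simp only: power2_diff) (simp add: power2_eq_square)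
    also have "\<dots> \<le> exp (3/8 * ?u\<^sup>2)" by (rule exp_ge_add_one_self)
    finally show ?thesis .
  qed
  moreover have "0 \<le> W y" by (simp add: W_def gibbs_weight_nonneg)
  ultimately have "?u * W y \<le> W m" by (meson mult_right_mono order.trans)
  moreover have "0 < sqrt (d * t)" using d t by simp
  ultimately show ?thesis unfolding m_def by (simp add: field_simps)
qed

text \<open>The difference is the mean of \<open>y - p\<close> under the normalized density
  \<open>W\<close>. Integrating the midpoint bound and substituting the midpoint leaves the integral
  of \<open>W\<close> itself on the right, and the normalization cancels.\<close>

lemma hj_prox_error:
  fixes h :: "'a::euclidean_space \<Rightarrow> ereal"
  assumes h: "lsc_fun h" "convex_fun h" and d: "0 < d" and t: "0 < t"
    and p: "subgradient h p ((v - p) /\<^sub>R t)"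
    and nz: "hj_denom d t h v \<noteq> 0"
  shows "norm (hj_prox d t h v - p) \<le> 2 ^ DIM('a) * sqrt (d * t)"
proof -
  note [measurable] = gibbs_weight_measurable[OF h(1), of d]
  define c where "c = (2 * pi * (d * t)) powr (- real DIM('a) / 2)"
  have c: "0 < c" unfolding c_def using d t by simp
  define W where "W y = c * (exp (- (norm (y - v))\<^sup>2 / (2 * (d * t))) * gibbs_weight h d y)" for y
  have W0: "0 \<le> W y" for y using c by (simp add: W_def gibbs_weight_nonneg)
  have [measurable]: "W \<in> borel_measurable borel" unfolding W_def by measurable
  have mid: "norm (y - p) * W y \<le> sqrt (d * t) * W ((1/2) *\<^sub>R p + (1/2) *\<^sub>R y)" for y
    using mult_left_mono[OF gibbs_midpoint[OF h(2) d t p, of y], of c] c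
    by (simp add: W_def algebra_simps)
  have Z: "hj_denom d t h v = (\<integral>y. W y \<partial>lborel)"
    unfolding hj_denom_def gaussian_def
    by (subst integral_density) (simp_all add: W_def[abs_def] c_def mult.assoc)
  have N: "(\<integral>y. gibbs_weight h d y *\<^sub>R y \<partial>gaussian v (d * t)) = (\<integral>y. W y *\<^sub>R y \<partial>lborel)"
    unfolding gaussian_def
    by (subst integral_density) (simp_all add: W_def c_def mult.assoc)
  \<comment> \<open>A Bochner integral defaults to 0 for a non-integrable function, so a nonzero
    denominator yields integrability.\<close>
  have iW: "integrable lborel W" using nz Z not_integrable_integral_eq by metis
  have Zpos: "0 < (\<integral>y. W y \<partial>lborel)"
    using nz Z W0 by (simp add: less_le Bochner_Integration.integral_nonneg)
  let ?M = "\<lambda>y. sqrt (d * t) * W ((1/2) *\<^sub>R p + (1/2) *\<^sub>R y)"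
  have iM: "integrable lborel ?M"
    using lborel_integral_affine(1)[OF iW, of "1/2" "(1/2) *\<^sub>R p"] by simp
  have M: "(\<integral>y. ?M y \<partial>lborel) = 2 ^ DIM('a) * sqrt (d * t) * (\<integral>y. W y \<partial>lborel)"
    using lborel_integral_affine(2)[OF iW, of "1/2" "(1/2) *\<^sub>R p"] by (simp add: field_simps power_divide)
  \<comment> \<open>The midpoint bound also provides the integrable majorant, so the first moment
    exists.\<close>
  have i1: "integrable lborel (\<lambda>y. W y *\<^sub>R (y - p))"
    by (rule Bochner_Integration.integrable_bound[OF iM])
      (use mid W0 d t in \<open>auto simp: mult.commute\<close>)
  have "(\<integral>y. W y *\<^sub>R y \<partial>lborel) = (\<integral>y. W y *\<^sub>R (y - p) + W y *\<^sub>R p \<partial>lborel)"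
    by (simp add: algebra_simps)
  also have "\<dots> = (\<integral>y. W y *\<^sub>R (y - p) \<partial>lborel) + (\<integral>y. W y \<partial>lborel) *\<^sub>R p"
    using i1 iW by (subst Bochner_Integration.integral_add) auto
  finally have "hj_prox d t h v - p = (\<integral>y. W y *\<^sub>R (y - p) \<partial>lborel) /\<^sub>R (\<integral>y. W y \<partial>lborel)"
    unfolding hj_prox_def Z N using Zpos by (simp add: scaleR_add_right)
  moreover have "norm (\<integral>y. W y *\<^sub>R (y - p) \<partial>lborel) \<le> (\<integral>y. ?M y \<partial>lborel)"
    by (rule Bochner_Integration.integral_norm_bound_integral[OF i1 iM]) (use mid W0 in \<open>auto simp: mult.commute\<close>)
  ultimately show ?thesis using Zpos unfolding M
    by (simp add: divide_inverse_commute[symmetric] pos_divide_le_eq)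
qed

section \<open>Gradient steps\<close>

text \<open>Along the segment, \<phi> is \<open>f\<close> minus its quadratic upper model up to a
  constant; the Lipschitz bound makes its derivative nonpositive, and
  \<open>\<phi> 1 \<le> \<phi> 0\<close> is the claim.\<close>

lemma smooth_descent:
  fixes f :: "'a::real_inner \<Rightarrow> real"
  assumes grad: "\<And>y. GDERIV f y :> grad_f y" and lip: "L-lipschitz_on UNIV grad_f"
  shows "f y \<le> f x + grad_f x \<bullet> (y - x) + L / 2 * (norm (y - x))\<^sup>2"
proof -
  define w where "w = y - x"
  define \<phi> where "\<phi> s = f (x + s *\<^sub>R w) - s * (grad_f x \<bullet> w) - L / 2 * s\<^sup>2 * (norm w)\<^sup>2" for s
  have "\<phi> 1 \<le> \<phi> 0"
  proof (rule DERIV_nonpos_imp_nonincreasing[of 0 1 \<phi>])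
    fix s :: real assume s: "0 \<le> s" "s \<le> 1"
    let ?d = "grad_f (x + s *\<^sub>R w) \<bullet> w - grad_f x \<bullet> w - L * s * (norm w)\<^sup>2"
    have "(\<phi> has_real_derivative ?d) (at s)"
      unfolding \<phi>_def
      by (auto intro!: derivative_eq_intros gderiv_along_line grad)
    moreover have "?d \<le> 0"
    proof -
      have "(grad_f (x + s *\<^sub>R w) - grad_f x) \<bullet> w \<le> norm (grad_f (x + s *\<^sub>R w) - grad_f x) * norm w"
        by (rule norm_cauchy_schwarz)
      also have "\<dots> \<le> (L * (s * norm w)) * norm w"
        using lipschitz_onD[OF lip, of "x + s *\<^sub>R w" x] s
        by (intro mult_right_mono) (auto simp: dist_norm)
      finally show ?thesis by (simp add: inner_diff_left power2_eq_square mult.assoc)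
    qed
    ultimately show "\<exists>d. DERIV \<phi> s :> d \<and> d \<le> 0" by blast
  qed simp
  then show ?thesis by (simp add: \<phi>_def w_def)
qed

text \<open>Convexity at \<open>x\<close> and the descent bound at \<open>y\<close>, both evaluated
  at one auxiliary point, sharpen the gradient inequality by a quadratic term; adding the version
  with \<open>x\<close> and \<open>y\<close> exchanged gives cocoercivity.\<close>

lemma baillon_haddad:
  fixes f :: "'a::real_inner \<Rightarrow> real"
  assumes conv: "convex_fun (\<lambda>y. ereal (f y))"
    and grad: "\<And>y. GDERIV f y :> grad_f y" and lip: "L-lipschitz_on UNIV grad_f" and L: "0 < L"
  shows "(norm (grad_f x - grad_f y))\<^sup>2 \<le> L * ((grad_f x - grad_f y) \<bullet> (x - y))"
proof -
  have half: "f x + grad_f x \<bullet> (y - x) + (norm (grad_f y - grad_f x))\<^sup>2 / (2 * L) \<le> f y" for x y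
  proof -
    define D where "D = grad_f y - grad_f x"
    \<comment> \<open>This point minimizes the quadratic upper model of \<open>f\<close> at
      \<open>y\<close> minus the linear function with slope \<open>grad_f x\<close>, which makes the
      gain largest.\<close>
    let ?y = "y - D /\<^sub>R L"
    have "f x + grad_f x \<bullet> (?y - x) \<le> f ?y"
      by (rule convex_gradient_inequality[OF conv grad])
    also have "\<dots> \<le> f y + grad_f y \<bullet> (?y - y) + L / 2 * (norm (?y - y))\<^sup>2"
      by (rule smooth_descent[OF grad lip])
    also have "L / 2 * (norm (?y - y))\<^sup>2 = (norm D)\<^sup>2 / (2 * L)"
    proof -
      have "norm (?y - y) = norm D / L" using L by (simp add: divide_inverse mult.commute)
      then show ?thesis using L by (simp add: power2_eq_square)
    qed
    finally have "f x + grad_f x \<bullet> (?y - x) \<le> f y + grad_f y \<bullet> (?y - y) + (norm D)\<^sup>2 / (2 * L)" .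
    moreover have "grad_f x \<bullet> (?y - x) = grad_f x \<bullet> (y - x) - (grad_f x \<bullet> D) / L"
      by (simp add: inner_diff_right divide_inverse mult.commute)
    moreover have "grad_f y \<bullet> (?y - y) = - ((grad_f y \<bullet> D) / L)"
      by (simp add: inner_diff_right divide_inverse mult.commute)
    moreover have "(grad_f y \<bullet> D) / L - (grad_f x \<bullet> D) / L = (norm D)\<^sup>2 / (2 * L) + (norm D)\<^sup>2 / (2 * L)"
    proof -
      have "(grad_f y \<bullet> D) / L - (grad_f x \<bullet> D) / L = (norm D)\<^sup>2 / L"
        by (simp only: diff_divide_distrib[symmetric] inner_diff_left[symmetric] D_def[symmetric] power2_norm_eq_inner)
      then show ?thesis by simp
    qed
    ultimately have "f x + grad_f x \<bullet> (y - x) + (norm D)\<^sup>2 / (2 * L) \<le> f y" by linarith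
    then show ?thesis by (simp add: D_def)
  qed
  have "(norm (grad_f x - grad_f y))\<^sup>2 / L \<le> (grad_f x - grad_f y) \<bullet> (x - y)"
  proof -
    have "(norm (grad_f x - grad_f y))\<^sup>2 / L
        = (norm (grad_f x - grad_f y))\<^sup>2 / (2 * L) + (norm (grad_f x - grad_f y))\<^sup>2 / (2 * L)"
      by simp
    moreover have "(grad_f x - grad_f y) \<bullet> (x - y) = - (grad_f x \<bullet> (y - x)) - grad_f y \<bullet> (x - y)"
      by (simp add: inner_diff_left inner_diff_right)
    ultimately show ?thesis
      using half[of x y] half[of y x] by (simp only: norm_minus_commute[of "grad_f y"])
  qed
  then show ?thesis using L by (simp add: pos_divide_le_eq mult.commute)
qed

text \<open>Expand the square and bound the cross term by cocoercivity. The gradient term is kept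
  because its coefficient is positive for \<open>t < 2 / L\<close>, which averagedness relies
  on.\<close>

lemma gradient_step_nonexpansive:
  fixes f :: "'a::real_inner \<Rightarrow> real"
  assumes "convex_fun (\<lambda>y. ereal (f y))"
    and "\<And>y. GDERIV f y :> grad_f y" and "L-lipschitz_on UNIV grad_f" and L: "0 < L" and t: "0 < t"
  shows "(norm ((x - t *\<^sub>R grad_f x) - (y - t *\<^sub>R grad_f y)))\<^sup>2
    \<le> (norm (x - y))\<^sup>2 - t * (2 / L - t) * (norm (grad_f x - grad_f y))\<^sup>2"
proof -
  let ?D = "grad_f x - grad_f y"
  have "(norm ?D)\<^sup>2 / L \<le> ?D \<bullet> (x - y)"
    using baillon_haddad[OF assms(1-4), of x y] L by (simp add: pos_divide_le_eq mult.commute)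
  then have "2 * t * ((norm ?D)\<^sup>2 / L) \<le> 2 * t * (?D \<bullet> (x - y))"
    using t by (intro mult_left_mono) auto
  moreover have "(norm ((x - t *\<^sub>R grad_f x) - (y - t *\<^sub>R grad_f y)))\<^sup>2 = (norm ((x - y) - t *\<^sub>R ?D))\<^sup>2"
    by (simp add: algebra_simps)
  moreover have "(norm ((x - y) - t *\<^sub>R ?D))\<^sup>2 = (norm (x - y))\<^sup>2 - 2 * t * (?D \<bullet> (x - y)) + t\<^sup>2 * (norm ?D)\<^sup>2"
    using dot_norm_neg[of "x - y" "t *\<^sub>R ?D"]
    by (simp add: inner_commute[of "x - y"] power_mult_distrib)
  moreover have "t * (2 / L - t) * (norm ?D)\<^sup>2 = 2 * t * ((norm ?D)\<^sup>2 / L) - t\<^sup>2 * (norm ?D)\<^sup>2"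
    by (simp add: algebra_simps power2_eq_square)
  ultimately show ?thesis by linarith
qed

text \<open>The proximal step loses \<open>(norm (r - w))\<^sup>2\<close> and the gradient step
  \<open>(2 / L - t) / t * (norm w)\<^sup>2\<close>. As \<open>(norm r)\<^sup>2\<close> is at most
  twice the sum of the two squared norms, \<open>c\<close> is half the smaller of the coefficients 1
  and \<open>(2 / L - t) / t\<close>.\<close>

lemma forward_backward_averaged:
  fixes f :: "'a::real_inner \<Rightarrow> real"
  assumes "convex_fun (\<lambda>y. ereal (f y))"
    and "\<And>y. GDERIV f y :> grad_f y" and "L-lipschitz_on UNIV grad_f" and "0 < L"
    and t: "0 < t" "t < 2 / L"
    and T: "\<And>x. subgradient h (T x) ((x - t *\<^sub>R grad_f x - T x) /\<^sub>R t)"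
  defines "c \<equiv> min (1/2) ((2 / L - t) / (2 * t))"
  shows "(norm (T x - T y))\<^sup>2 \<le> (norm (x - y))\<^sup>2 - c * (norm ((x - y) - (T x - T y)))\<^sup>2"
proof -
  define r where "r = (x - y) - (T x - T y)"
  define w where "w = t *\<^sub>R (grad_f x - grad_f y)"
  have "(norm (T x - T y))\<^sup>2 \<le> (norm ((x - t *\<^sub>R grad_f x) - (y - t *\<^sub>R grad_f y)))\<^sup>2
     - (norm ((x - t *\<^sub>R grad_f x) - (y - t *\<^sub>R grad_f y) - (T x - T y)))\<^sup>2"
    by (rule prox_firmly_nonexpansive[OF T T t(1)])
  also have "(x - t *\<^sub>R grad_f x) - (y - t *\<^sub>R grad_f y) - (T x - T y) = r - w"
    by (simp add: r_def w_def algebra_simps)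
  finally have 1: "(norm (T x - T y))\<^sup>2
      \<le> (norm (x - y))\<^sup>2 - t * (2 / L - t) * (norm (grad_f x - grad_f y))\<^sup>2 - (norm (r - w))\<^sup>2"
    using gradient_step_nonexpansive[OF assms(1-4) t(1), of x y] by linarith
  have c: "0 \<le> c" "2 * c \<le> 1" "2 * c \<le> (2 / L - t) / t"
  proof -
    show "0 \<le> c" "2 * c \<le> 1" using t by (simp_all add: c_def)
    have "c \<le> (2 / L - t) / (2 * t)" unfolding c_def by (rule min.cobounded2)
    then show "2 * c \<le> (2 / L - t) / t" using t(1) by (simp add: field_simps)
  qed
  have "(norm r)\<^sup>2 \<le> 2 * (norm (r - w))\<^sup>2 + 2 * (norm w)\<^sup>2"
  proof -
    have "0 \<le> (norm (r - w - w))\<^sup>2" by simp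
    then show ?thesis by (simp add: power2_norm_eq_inner inner_simps inner_commute)
  qed
  from mult_left_mono[OF this c(1)]
  have "c * (norm r)\<^sup>2 \<le> (2 * c) * (norm (r - w))\<^sup>2 + (2 * c) * (norm w)\<^sup>2" by (simp add: algebra_simps)
  also have "\<dots> \<le> 1 * (norm (r - w))\<^sup>2 + (2 / L - t) / t * (norm w)\<^sup>2"
    using c by (intro add_mono mult_right_mono) auto
  also have "(2 / L - t) / t * (norm w)\<^sup>2 = t * (2 / L - t) * (norm (grad_f x - grad_f y))\<^sup>2"
    using t(1) by (simp add: w_def power_mult_distrib power2_eq_square)
  finally show ?thesis using 1 by (simp add: r_def)
qed

section \<open>Fixed point iterations with summable errors\<close>

text \<open>Subtracting the partial sums of the errors leaves a nonincreasing sequence bounded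
  below.\<close>

lemma quasi_monotone_convergent:
  fixes a e :: "nat \<Rightarrow> real"
  assumes "\<And>k. 0 \<le> a k" "\<And>k. 0 \<le> e k" "\<And>k. a (Suc k) \<le> a k + e k" "summable e"
  shows "convergent a"
proof -
  define b where "b k = a k - (\<Sum>i<k. e i)" for k
  have "decseq b" using assms(3) by (intro decseq_SucI) (simp add: b_def algebra_simps)
  moreover have "- suminf e \<le> b k" for k
    using assms(1)[of k] sum_le_suminf[OF assms(4), of "{..<k}"] assms(2) by (simp add: b_def)
  ultimately have "convergent b" using decseq_convergent[of b] unfolding convergent_def by metis
  moreover have "convergent (\<lambda>k. \<Sum>i<k. e i)"
    using assms(4) by (simp add: summable_iff_convergent)
  ultimately have "convergent (\<lambda>k. b k + (\<Sum>i<k. e i))" by (rule convergent_add)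
  then show ?thesis by (simp add: b_def)
qed

lemma averaged_iteration_converges:
  fixes T :: "'a::euclidean_space \<Rightarrow> 'a" and X :: "nat \<Rightarrow> 'a"
  assumes c: "0 < c"
    and avg: "\<And>x y. (norm (T x - T y))\<^sup>2 \<le> (norm (x - y))\<^sup>2 - c * (norm ((x - y) - (T x - T y)))\<^sup>2"
    and fp: "T z = z"
    and err: "\<And>k. norm (X (Suc k) - T (X k)) \<le> e k" and e: "summable e"
  obtains w where "T w = w" "X \<longlonglongrightarrow> w"
proof -
  have nonexp: "norm (T x - T y) \<le> norm (x - y)" for x y
  proof (rule power2_le_imp_le)
    have "0 \<le> c * (norm ((x - y) - (T x - T y)))\<^sup>2" using c by simp
    then show "(norm (T x - T y))\<^sup>2 \<le> (norm (x - y))\<^sup>2" using avg[of x y] by linarith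
  qed simp
  have e0: "0 \<le> e k" for k using order.trans[OF norm_ge_zero err] .
  have step: "norm (X (Suc k) - v) \<le> norm (T (X k) - v) + e k" for k v
    using err[of k] norm_triangle_ineq[of "X (Suc k) - T (X k)" "T (X k) - v"] by simp
  have conv: "convergent (\<lambda>k. norm (X k - v))" if "T v = v" for v
  proof (rule quasi_monotone_convergent[OF _ e0 _ e])
    show "norm (X (Suc k) - v) \<le> norm (X k - v) + e k" for k
      using step[of k v] nonexp[of "X k" v] that by simp
  qed simp
  from conv[OF fp] obtain l where l: "(\<lambda>k. norm (X k - z)) \<longlonglongrightarrow> l" unfolding convergent_def by blast
  \<comment> \<open>The distance after an exact step is squeezed between two consecutive distances
    of the sequence, up to the vanishing error.\<close>
  have Tl: "(\<lambda>k. norm (T (X k) - z)) \<longlonglongrightarrow> l"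
  proof (rule tendsto_sandwich[OF _ _ _ l])
    show "(\<lambda>k. norm (X (Suc k) - z) - e k) \<longlonglongrightarrow> l"
      using tendsto_diff[OF LIMSEQ_Suc[OF l] summable_LIMSEQ_zero[OF e]] by simp
    show "\<forall>\<^sub>F k in sequentially. norm (X (Suc k) - z) - e k \<le> norm (T (X k) - z)"
      using step[of _ z] by (intro always_eventually allI) (simp add: algebra_simps)
    show "\<forall>\<^sub>F k in sequentially. norm (T (X k) - z) \<le> norm (X k - z)"
      using nonexp[of _ z] fp by (intro always_eventually allI) simp
  qed
  \<comment> \<open>Averagedness against the fixed point \<open>z\<close> bounds the squared
    residual by a difference of squares whose terms share the limit
    \<open>l\<^sup>2\<close>.\<close>
  have reg: "(\<lambda>k. X k - T (X k)) \<longlonglongrightarrow> 0"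
  proof -
    have "(\<lambda>k. ((norm (X k - z))\<^sup>2 - (norm (T (X k) - z))\<^sup>2) / c) \<longlonglongrightarrow> (l\<^sup>2 - l\<^sup>2) / c"
      by (intro tendsto_intros l Tl) (use c in auto)
    then have "(\<lambda>k. ((norm (X k - z))\<^sup>2 - (norm (T (X k) - z))\<^sup>2) / c) \<longlonglongrightarrow> 0" by simp
    then have "(\<lambda>k. (norm (X k - T (X k)))\<^sup>2) \<longlonglongrightarrow> 0"
    proof (rule tendsto_sandwich[OF _ _ tendsto_const, rotated 2])
      show "\<forall>\<^sub>F k in sequentially. (norm (X k - T (X k)))\<^sup>2 \<le> ((norm (X k - z))\<^sup>2 - (norm (T (X k) - z))\<^sup>2) / c"
        using avg[of _ z] fp c
        by (intro always_eventually allI) (simp add: pos_le_divide_eq algebra_simps)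
    qed simp
    from tendsto_real_sqrt[OF this] show ?thesis by (simp add: tendsto_norm_zero_iff)
  qed
  have "Bseq (\<lambda>k. X k + (- z))"
    using convergent_imp_Bseq[OF conv[OF fp]] by (simp add: Bseq_def)
  then have "Bseq X" by (simp only: Bseq_add_iff)
  then have "bounded (range X)" by (simp add: Bseq_eq_bounded)
  then obtain w r where r: "strict_mono r" "(X \<circ> r) \<longlonglongrightarrow> w"
    using bounded_imp_convergent_subsequence by blast
  have "(\<lambda>k. T (X (r k))) \<longlonglongrightarrow> w"
    using tendsto_diff[OF r(2) LIMSEQ_subseq_LIMSEQ[OF reg r(1)]] by (simp add: o_def)
  moreover have "(\<lambda>k. T (X (r k))) \<longlonglongrightarrow> T w"
  proof -
    have "(\<lambda>k. norm (X (r k) - w)) \<longlonglongrightarrow> 0"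
      using r(2) by (simp add: o_def LIM_zero_iff tendsto_norm_zero_iff)
    then have "(\<lambda>k. norm (T (X (r k)) - T w)) \<longlonglongrightarrow> 0"
      by (rule tendsto_sandwich[OF _ _ tendsto_const, rotated 2]) (auto intro!: always_eventually nonexp)
    then show ?thesis by (simp add: LIM_zero_iff tendsto_norm_zero_iff)
  qed
  ultimately have w: "T w = w" using LIMSEQ_unique by blast
  \<comment> \<open>The cluster point \<open>w\<close> is itself a fixed point, so the distance to
    it converges along the whole sequence; the subsequence identifies the limit as 0.\<close>
  obtain l' where l': "(\<lambda>k. norm (X k - w)) \<longlonglongrightarrow> l'" using conv[OF w] unfolding convergent_def by blast
  have "(\<lambda>k. norm (X (r k) - w)) \<longlonglongrightarrow> 0"
    using r(2) by (simp add: o_def LIM_zero_iff tendsto_norm_zero_iff)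
  then have "l' = 0"
    using LIMSEQ_subseq_LIMSEQ[OF l' r(1)] LIMSEQ_unique by (force simp: o_def)
  then have "X \<longlonglongrightarrow> w" using l' by (simp add: LIM_zero_iff tendsto_norm_zero_iff)
  with w show thesis using that by blast
qed

section \<open>Convergence of the inexact proximal gradient iteration\<close>

text \<open>One direction is Fermat's rule; for the other, the gradient inequality of
  \<open>f\<close> and the subgradient inequality of \<open>g\<close> are added, and their opposite
  slopes cancel.\<close>

lemma minimizer_subgradient:
  fixes f :: "'a::real_inner \<Rightarrow> real"
  assumes f: "convex_fun (\<lambda>y. ereal (f y))" "GDERIV f z :> d"
    and g: "proper_fun g" "convex_fun g"
  shows "is_arg_min (\<lambda>y. ereal (f y) + g y) (\<lambda>_. True) z \<longleftrightarrow> subgradient g z (- d)"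
proof
  assume "is_arg_min (\<lambda>y. ereal (f y) + g y) (\<lambda>_. True) z"
  then show "subgradient g z (- d)"
    by (intro fermat_subgradient[OF g f(2)]) (auto simp: is_arg_min_linorder)
next
  assume s: "subgradient g z (- d)"
  then obtain r where r: "g z = ereal r" "\<And>y. ereal (r + (- d) \<bullet> (y - z)) \<le> g y"
    using subgradient_finite by blast
  have "ereal (f z) + g z \<le> ereal (f y) + g y" for y
    using r(1) r(2)[of y] convex_gradient_inequality[OF f, of y] by (cases "g y") auto
  then show "is_arg_min (\<lambda>y. ereal (f y) + g y) (\<lambda>_. True) z" by (simp add: is_arg_min_linorder)
qed

theorem theorem3:
  fixes f :: "real ^ 'n \<Rightarrow> real"
    and g :: "real ^ 'n \<Rightarrow> ereal"
    and grad_f :: "real ^ 'n \<Rightarrow> real ^ 'n"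
    and L t :: real
    and \<delta> :: "nat \<Rightarrow> real"
    and x :: "nat \<Rightarrow> real ^ 'n"
  assumes f: "proper_fun (\<lambda>y. ereal (f y))" "lsc_fun (\<lambda>y. ereal (f y))"
      "convex_fun (\<lambda>y. ereal (f y))"
    and g: "proper_fun g" "lsc_fun g" "convex_fun g"
    and f_grad: "\<And>y. GDERIV f y :> grad_f y"
    and f_smooth: "L-lipschitz_on UNIV grad_f"
    and step: "0 < t" "t < 2 / L"
    and \<delta>_pos: "\<And>k. k \<ge> 1 \<Longrightarrow> \<delta> k > 0"
    and \<delta>_summable: "summable (\<lambda>k. sqrt (\<delta> (Suc k)))"
    and minimizer_exists: "\<exists>z. is_arg_min (\<lambda>y. ereal (f y) + g y) (\<lambda>_. True) z"
    and well_defined: "\<And>k. k \<ge> 1 \<Longrightarrow> hj_denom (\<delta> k) t g (x k - t *\<^sub>R grad_f (x k)) \<noteq> 0"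
    and iteration: "\<And>k. k \<ge> 1 \<Longrightarrow> x (Suc k) = hj_prox (\<delta> k) t g (x k - t *\<^sub>R grad_f (x k))"
  shows "\<exists>z. is_arg_min (\<lambda>y. ereal (f y) + g y) (\<lambda>_. True) z \<and> x \<longlonglongrightarrow> z"
proof -
  \<comment> \<open>Since \<open>2 / 0 = 0\<close>, the bounds on \<open>t\<close> exclude
    \<open>L = 0\<close> as well as negative \<open>L\<close>.\<close>
  have L: "0 < L" using step by (smt (verit) divide_nonneg_nonpos)
  note min_iff = minimizer_subgradient[OF f(3) f_grad g(1,3)]
  obtain z where z: "subgradient g z (- grad_f z)" using minimizer_exists min_iff by blast
  \<comment> \<open>\<open>T\<close> is the forward-backward operator; the subgradient of
    \<open>g\<close> at the minimizer \<open>z\<close> guarantees that the choice exists.\<close>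
  define T where "T v = (SOME p. subgradient g p ((v - t *\<^sub>R grad_f v - p) /\<^sub>R t))" for v
  have T: "subgradient g (T v) ((v - t *\<^sub>R grad_f v - T v) /\<^sub>R t)" for v
    unfolding T_def using prox_exists[OF g step(1) z] by (rule someI_ex) blast
  have fixed_iff: "T v = v \<longleftrightarrow> subgradient g v (- grad_f v)" for v
  proof
    assume "T v = v"
    then show "subgradient g v (- grad_f v)" using T[of v] step(1) by simp
  next
    assume "subgradient g v (- grad_f v)"
    \<comment> \<open>Now \<open>v\<close> and \<open>T v\<close> are both proximal points of the
      same gradient step, and firm nonexpansiveness forces them to agree.\<close>
    then have "subgradient g v ((v - t *\<^sub>R grad_f v - v) /\<^sub>R t)" using step(1) by simp
    from prox_firmly_nonexpansive[OF T[of v] this step(1)] have "(norm (T v - v))\<^sup>2 \<le> 0"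
      by (rule order.trans) simp
    then show "T v = v" by simp
  qed
  define c where "c = min (1/2) ((2 / L - t) / (2 * t))"
  have "0 < c" using step by (simp add: c_def)
  define C where "C = 2 ^ DIM(real ^ 'n) * sqrt t"
  \<comment> \<open>The recursion starts at index 1, so the fixed point argument runs on the
    sequence \<open>\<lambda>k. x (Suc k)\<close>, matching the summability hypothesis.\<close>
  have err: "norm (x (Suc (Suc k)) - T (x (Suc k))) \<le> C * sqrt (\<delta> (Suc k))" for k
    using hj_prox_error[OF g(2,3) \<delta>_pos step(1) T well_defined, of "Suc k"] iteration[of "Suc k"]
    by (simp add: C_def real_sqrt_mult mult_ac)
  obtain w where w: "T w = w" "(\<lambda>k. x (Suc k)) \<longlonglongrightarrow> w"
    by (rule averaged_iteration_converges[OF \<open>0 < c\<close>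
          forward_backward_averaged[OF f(3) f_grad f_smooth L step T, folded c_def]
          fixed_iff[THEN iffD2, OF z] err summable_mult[OF \<delta>_summable]])
  have "is_arg_min (\<lambda>y. ereal (f y) + g y) (\<lambda>_. True) w"
    using w(1) by (simp add: min_iff fixed_iff)
  moreover have "x \<longlonglongrightarrow> w" using w(2) by (rule LIMSEQ_imp_Suc)
  ultimately show ?thesis by blast
qed

end
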